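(* For every integer $r\ge 4$ there exist $\beta_r>0$ and $n_0(r)$ such that for all $n\ge n_0(r)$ with $r\mid n$ there exists a $k$-regular optimal $r$-superimposed design on $n$ vertices for every integer $k$ with $1\le k\le n e^{-\beta_r\sqrt{\log n}}$; in particular $$n e^{-\beta_r\sqrt{\log n}}\le k'(r,n).$$
   Context: A family $\mathcal F$ of subsets of an $n$-element vertex set is $e$-cover-free if for any distinct members $A_0,A_1,\dots,A_e\in\mathcal F$ one has $A_0\not\subseteq\bigcup_{i=1}^e A_i$; it is $e$-union-free if for any two distinct subfamilies $\mathcal A,\mathcal B\subseteq\mathcal F$ with $0<|\mathcal A|,|\mathcal B|\le e$ one has $\bigcup_{A\in\mathcal A}A\ne\bigcup_{B\in\mathcal B}B$. A hypergraph is linear if any two distinct edges share at most one vertex, and $k$-regular if every vertex lies in exactly $k$ edges. An $n$-vertex $k$-regular family $\mathcal F$ is called an optimal $(r-1)$-superimposed code if it is an $(r-1)$-cover-free, $r$-uniform, $k$-regular, linear hypergraph; it is an optimal $r$-superimposed design if in addition it is $r$-union-free. $k'(r,n)$ denotes the maximum $k$ for which a $k$-regular optimal $r$-superimposed design on $n$ vertices exists. *)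

theory Defs
  imports Complex_Main
begin

definition cover_free :: "nat \<Rightarrow> 'a set set \<Rightarrow> bool" where
  "cover_free e F \<longleftrightarrow>
     (\<forall>A :: nat \<Rightarrow> 'a set. inj_on A {0..e} \<and> A ` {0..e} \<subseteq> F \<longrightarrow>
        \<not> A 0 \<subseteq> (\<Union>i\<in>{1..e}. A i))"

definition union_free :: "nat \<Rightarrow> 'a set set \<Rightarrow> bool" where
  "union_free e F \<longleftrightarrow>
     (\<forall>\<A> \<B>. \<A> \<subseteq> F \<and> \<B> \<subseteq> F \<and> \<A> \<noteq> \<B> \<and>
        0 < card \<A> \<and> card \<A> \<le> e \<and> 0 < card \<B> \<and> card \<B> \<le> e \<longrightarrow>
        \<Union>\<A> \<noteq> \<Union>\<B>)"

definition uniform :: "nat \<Rightarrow> 'a set set \<Rightarrow> bool" where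
  "uniform r F \<longleftrightarrow> (\<forall>A\<in>F. card A = r)"

definition regular :: "nat \<Rightarrow> 'a set \<Rightarrow> 'a set set \<Rightarrow> bool" where
  "regular k V F \<longleftrightarrow> (\<forall>v\<in>V. card {A \<in> F. v \<in> A} = k)"

definition linear_hypergraph :: "'a set set \<Rightarrow> bool" where
  "linear_hypergraph F \<longleftrightarrow> (\<forall>A\<in>F. \<forall>B\<in>F. A \<noteq> B \<longrightarrow> card (A \<inter> B) \<le> 1)"

text \<open>The first argument is \<open>r\<close>; the code is an optimal \<open>(r - 1)\<close>-superimposed code.\<close>

definition optimal_superimposed_code :: "nat \<Rightarrow> nat \<Rightarrow> 'a set \<Rightarrow> 'a set set \<Rightarrow> bool" where
  "optimal_superimposed_code r k V F \<longleftrightarrow>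
     finite V \<and> F \<subseteq> Pow V \<and>
     cover_free (r - 1) F \<and> uniform r F \<and> regular k V F \<and> linear_hypergraph F"

text \<open>With the same \<open>r\<close>, this is an optimal \<open>r\<close>-superimposed design.\<close>

definition optimal_superimposed_design :: "nat \<Rightarrow> nat \<Rightarrow> 'a set \<Rightarrow> 'a set set \<Rightarrow> bool" where
  "optimal_superimposed_design r k V F \<longleftrightarrow>
     optimal_superimposed_code r k V F \<and> union_free r F"

definition design_degrees :: "nat \<Rightarrow> nat \<Rightarrow> nat set" where
  "design_degrees r n = {k. \<exists>F. optimal_superimposed_design r k {..<n} F}"

text \<open>The quantity \<open>k'(r,n)\<close>. The maximum is over a finite nonempty set as soon as \<open>n > 0\<close>; the
  empty family always gives degree 0. For \<open>n = 0\<close> regularity is vacuous and the value is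
  meaningless.\<close>

definition max_design_degree :: "nat \<Rightarrow> nat \<Rightarrow> nat" where
  "max_design_degree r n = Max (design_degrees r n)"

lemma finite_design_degrees:
  assumes "n > 0"
  shows "finite (design_degrees r n)"
proof (rule finite_subset)
  show "design_degrees r n \<subseteq> {..card (Pow {..<n})}"
  proof
    fix k assume "k \<in> design_degrees r n"
    then obtain F where F: "F \<subseteq> Pow {..<n}" and "regular k {..<n} F"
      by (auto simp: design_degrees_def optimal_superimposed_design_def
          optimal_superimposed_code_def)
    with assms have "card {A \<in> F. 0 \<in> A} = k"
      by (auto simp: regular_def)
    moreover have "card {A \<in> F. 0 \<in> A} \<le> card (Pow {..<n})"
      using F by (intro card_mono) auto
    ultimately show "k \<in> {..card (Pow {..<n})}" by simp
  qed
qed simp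

lemma zero_in_design_degrees: "0 \<in> design_degrees r n"
proof -
  have "optimal_superimposed_design r 0 {..<n} {}"
    by (auto simp: optimal_superimposed_design_def optimal_superimposed_code_def
        cover_free_def uniform_def regular_def linear_hypergraph_def union_free_def)
  then show ?thesis by (auto simp: design_degrees_def)
qed

end

theory Submission
  imports Defs "HOL-Library.FuncSet"
begin

text \<open>
  Write \<open>n = r * m\<close> and split the vertices into \<open>r\<close> copies of the integers modulo \<open>m\<close>, one for each
  colour \<open>i < r\<close>. Fix integers \<open>c 0 < \<dots> < c (r - 1)\<close> and a set \<open>S\<close> of small non-negative integers.
  The edges are the \<^emph>\<open>lines\<close> \<open>(x, s)\<close> with \<open>x\<close> modulo \<open>m\<close> and \<open>s \<in> S\<close>; such a line has the vertex
  \<open>x + c i * s\<close> in the copy of colour \<open>i\<close>. For each slope \<open>s\<close> there is exactly one line through a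
  given vertex, so the family is regular of degree \<open>card S\<close>, and subsets of \<open>S\<close> give all smaller
  degrees. Two lines that meet in two colours have equal slopes, because a small multiple of the
  difference of the slopes vanishes modulo \<open>m\<close>; hence the family is linear. In a linear
  \<open>r\<close>-uniform family an edge is covered by other edges only if there are at least \<open>r\<close> of them,
  which gives cover-freeness.

  The slopes are chosen as in Behrend's theorem: no element of \<open>S\<close> is a proper weighted average
  of three elements with small integer weights. Going around a triangle, or around a quadrilateral
  whose four corners have cyclically monotone colours, expresses the slope of one side as an average
  of the others, so such configurations do not exist (\<open>no_monotone_quadrilateral\<close>). Sets \<open>S\<close> of
  size \<open>n * exp (- \<beta> * sqrt (ln n))\<close> are obtained by writing the points \<open>(x, \<bar>x\<bar>\<^sup>2)\<close> of a
  paraboloid as digit strings (\<open>large_average_free_sets\<close>).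

  Suppose that two different subfamilies of at most \<open>r\<close> edges have the same union. By counting, an
  edge that is only in one of them meets every edge of the other exactly once, and the absence of
  triangles makes the two families disjoint. So they form an \<open>r \<times> r\<close> grid, and the colours of its
  crossings form a Latin square. The absence of monotone quadrilaterals forces this Latin square
  to be the addition table modulo \<open>r\<close> (\<open>grid_row_shift\<close>, \<open>grid_cyclic\<close>). Such grids do exist over the
  reals: up to a projective map, the sides of a regular polygon with \<open>2 * r\<close> vertices, taken
  alternately, cross in this pattern. But they constrain the numbers \<open>c i\<close>, and these are chosen
  to violate the constraint: \<open>c 0\<close> and \<open>c 1\<close> are tiny while all others are huge. The crossings of colours \<open>0\<close> and \<open>1\<close> connect
  the whole grid and show that the positions \<open>x\<close> of all its lines are close to each other. At
  crossings of colours \<open>2\<close> and \<open>3\<close> the huge factor turns this into almost equal slopes, and as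
  these crossings connect the whole grid as well, the spread of the slopes is smaller than
  itself unless it is zero (\<open>no_cyclic_grid\<close>). Having two such pairs of colours
  requires \<open>r \<ge> 4\<close>.
\<close>

section \<open>Slope sets without weighted averages\<close>

definition average_free :: "int \<Rightarrow> int set \<Rightarrow> bool" where
  "average_free C S \<longleftrightarrow>
     (\<forall>s\<in>S. \<forall>t\<in>S. \<forall>u\<in>S. \<forall>v\<in>S. \<forall>\<alpha> \<beta> \<gamma>.
        0 < \<alpha> \<and> 0 \<le> \<beta> \<and> 0 \<le> \<gamma> \<and> \<alpha> + \<beta> + \<gamma> \<le> C \<and>
        \<alpha> * s + \<beta> * t + \<gamma> * u = (\<alpha> + \<beta> + \<gamma>) * v \<longrightarrow> s = v)"

lemma average_freeD:
  assumes "average_free C S" "s \<in> S" "t \<in> S" "u \<in> S" "v \<in> S"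
    "0 < \<alpha>" "0 \<le> \<beta>" "0 \<le> \<gamma>" "\<alpha> + \<beta> + \<gamma> \<le> C"
    "\<alpha> * s + \<beta> * t + \<gamma> * u = (\<alpha> + \<beta> + \<gamma>) * v"
  shows "s = v"
  using assms unfolding average_free_def by blast

lemma average_free_mono: "average_free C S \<Longrightarrow> T \<subseteq> S \<Longrightarrow> average_free C T"
  unfolding average_free_def by blast

text \<open>No carries: reducing modulo \<open>B\<close> kills the lowest digit, and so on upwards. The leading digit
  may be of any size.\<close>

lemma digits_zero:
  fixes e :: "nat \<Rightarrow> int"
  assumes "(\<Sum>i\<le>d. e i * B ^ i) = 0" "\<And>i. i < d \<Longrightarrow> \<bar>e i\<bar> < B" "i \<le> d"
  shows "e i = 0"
  using assms
proof (induction d arbitrary: e i)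
  case 0
  then show ?case by simp
next
  case (Suc d)
  have B: "B > 0" using Suc.prems(2)[of 0] by simp
  have split: "(\<Sum>i\<le>Suc d. e i * B ^ i) = e 0 + B * (\<Sum>i\<le>d. e (Suc i) * B ^ i)"
    by (subst sum.atMost_Suc_shift) (simp add: sum_distrib_left algebra_simps)
  have "B dvd e 0"
    using Suc.prems(1) split by (metis add_eq_0_iff dvd_minus_iff dvd_triv_left)
  then have e0: "e 0 = 0"
    using Suc.prems(2)[of 0] zdvd_imp_le[of B "\<bar>e 0\<bar>"] by auto
  then have "(\<Sum>i\<le>d. e (Suc i) * B ^ i) = 0"
    using split Suc.prems(1) B by simp
  then have "e (Suc i) = 0" if "i \<le> d" for i
    using Suc.IH[of "\<lambda>i. e (Suc i)" i] Suc.prems(2) that by auto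
  then show ?case using e0 Suc.prems(3) by (cases i) auto
qed

text \<open>The point \<open>x\<close> lifted to the paraboloid and read as a number in base \<open>B\<close>. The lift puts the
  points in convex position. The sum of squares comes last because it may exceed the base, which
  only the leading digit tolerates.\<close>

definition paraboloid_code :: "int \<Rightarrow> nat \<Rightarrow> (nat \<Rightarrow> int) \<Rightarrow> int" where
  "paraboloid_code B d x = (\<Sum>i<d. x i * B ^ i) + (\<Sum>i<d. (x i)\<^sup>2) * B ^ d"

lemma paraboloid_code_combination_zero:
  assumes B: "\<And>i. i < d \<Longrightarrow> \<bar>\<alpha> * x i + \<beta> * y i + \<gamma> * z i - \<delta> * w i\<bar> < B"
    and eq: "\<alpha> * paraboloid_code B d x + \<beta> * paraboloid_code B d y + \<gamma> * paraboloid_code B d z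
      = \<delta> * paraboloid_code B d w"
  shows "\<forall>i<d. \<alpha> * x i + \<beta> * y i + \<gamma> * z i = \<delta> * w i"
    and "(\<Sum>i<d. \<alpha> * (x i)\<^sup>2 + \<beta> * (y i)\<^sup>2 + \<gamma> * (z i)\<^sup>2 - \<delta> * (w i)\<^sup>2) = 0"
proof -
  define q where "q = (\<Sum>i<d. \<alpha> * (x i)\<^sup>2 + \<beta> * (y i)\<^sup>2 + \<gamma> * (z i)\<^sup>2 - \<delta> * (w i)\<^sup>2)"
  define e where "e = (\<lambda>i. if i < d then \<alpha> * x i + \<beta> * y i + \<gamma> * z i - \<delta> * w i else q)"
  have "(\<Sum>i\<le>d. e i * B ^ i) = (\<Sum>i<d. e i * B ^ i) + e d * B ^ d"
    by (simp add: lessThan_Suc_atMost[symmetric])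
  also have "(\<Sum>i<d. e i * B ^ i)
      = (\<Sum>i<d. (\<alpha> * x i + \<beta> * y i + \<gamma> * z i - \<delta> * w i) * B ^ i)"
    by (intro sum.cong) (auto simp: e_def)
  also have "\<dots> + e d * B ^ d = \<alpha> * paraboloid_code B d x + \<beta> * paraboloid_code B d y
      + \<gamma> * paraboloid_code B d z - \<delta> * paraboloid_code B d w"
    by (simp add: e_def q_def paraboloid_code_def sum_distrib_left sum_distrib_right
        sum.distrib sum_subtractf algebra_simps)
  finally have sum0: "(\<Sum>i\<le>d. e i * B ^ i) = 0" using eq by simp
  have e: "e i = 0" if "i \<le> d" for i
    using digits_zero[OF sum0 _ that] B by (auto simp: e_def)
  show "\<forall>i<d. \<alpha> * x i + \<beta> * y i + \<gamma> * z i = \<delta> * w i"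
  proof (intro allI impI)
    fix i assume "i < d"
    then show "\<alpha> * x i + \<beta> * y i + \<gamma> * z i = \<delta> * w i" using e[of i] by (simp add: e_def)
  qed
  show "(\<Sum>i<d. \<alpha> * (x i)\<^sup>2 + \<beta> * (y i)\<^sup>2 + \<gamma> * (z i)\<^sup>2 - \<delta> * (w i)\<^sup>2) = 0"
    using e[of d] by (simp add: e_def q_def)
qed

abbreviation digit_vectors :: "nat \<Rightarrow> nat \<Rightarrow> (nat \<Rightarrow> int) set" where
  "digit_vectors b d \<equiv> {..<d} \<rightarrow>\<^sub>E {0..<int b}"

lemma digit_vectors_bounds: "x \<in> digit_vectors b d \<Longrightarrow> i < d \<Longrightarrow> 0 \<le> x i \<and> x i < int b"
  using PiE_mem[of x "{..<d}" "\<lambda>_. {0..<int b}" i] by simp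

lemma paraboloid_code_inj_on:
  assumes "1 \<le> C"
  shows "inj_on (paraboloid_code (C * int b) d) (digit_vectors b d)"
proof (rule inj_onI)
  fix x y assume xy: "x \<in> digit_vectors b d" "y \<in> digit_vectors b d"
    and eq: "paraboloid_code (C * int b) d x = paraboloid_code (C * int b) d y"
  have Cb: "int b \<le> C * int b" using assms by (simp add: mult_le_cancel_right1)
  have "\<bar>1 * x i + 0 * y i + 0 * y i - 1 * y i\<bar> < C * int b" if "i < d" for i
  proof -
    note xy[THEN digit_vectors_bounds, OF that]
    then show ?thesis using Cb by linarith
  qed
  from paraboloid_code_combination_zero(1)[OF this] eq have "\<forall>i<d. x i = y i" by simp
  then show "x = y" using xy by (intro PiE_ext[OF xy]) simp
qed

text \<open>A coincidence among weighted averages passes to the digits and to the sums of their squares;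
  strict convexity of the square then makes all points with positive weight equal.\<close>

lemma paraboloid_code_average_free:
  "average_free C (paraboloid_code (C * int b) d ` digit_vectors b d)"
  unfolding average_free_def
proof (intro ballI allI impI, elim imageE, elim conjE)
  fix s t u v \<alpha> \<beta> \<gamma> x y z w
  assume vec: "x \<in> digit_vectors b d" "y \<in> digit_vectors b d" "z \<in> digit_vectors b d"
      "w \<in> digit_vectors b d"
    and code: "s = paraboloid_code (C * int b) d x" "t = paraboloid_code (C * int b) d y"
      "u = paraboloid_code (C * int b) d z" "v = paraboloid_code (C * int b) d w"
    and pos: "0 < \<alpha>" "0 \<le> \<beta>" "0 \<le> \<gamma>" and C: "\<alpha> + \<beta> + \<gamma> \<le> C"
    and eq: "\<alpha> * s + \<beta> * t + \<gamma> * u = (\<alpha> + \<beta> + \<gamma>) * v"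
  have small: "\<bar>\<alpha> * x i + \<beta> * y i + \<gamma> * z i - (\<alpha> + \<beta> + \<gamma>) * w i\<bar> < C * int b"
    if "i < d" for i
  proof -
    define b' where "b' = int b - 1"
    note d = vec[THEN digit_vectors_bounds, OF that]
    then have le: "x i \<le> b'" "y i \<le> b'" "z i \<le> b'" "w i \<le> b'" and b': "0 \<le> b'"
      by (auto simp: b'_def)
    have "\<alpha> * x i \<le> \<alpha> * b'" "\<beta> * y i \<le> \<beta> * b'" "\<gamma> * z i \<le> \<gamma> * b'"
      "(\<alpha> + \<beta> + \<gamma>) * w i \<le> (\<alpha> + \<beta> + \<gamma>) * b'"
      using le pos by (auto intro!: mult_left_mono)
    moreover have "0 \<le> \<alpha> * x i" "0 \<le> \<beta> * y i" "0 \<le> \<gamma> * z i" "0 \<le> (\<alpha> + \<beta> + \<gamma>) * w i"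
      using d pos by auto
    moreover have "(\<alpha> + \<beta> + \<gamma>) * b' \<le> C * b'" using C b' by (rule mult_right_mono)
    moreover have "C * b' < C * int b" using C pos by (simp add: b'_def)
    moreover have "(\<alpha> + \<beta> + \<gamma>) * b' = \<alpha> * b' + \<beta> * b' + \<gamma> * b'" by (simp add: algebra_simps)
    ultimately show ?thesis by linarith
  qed
  note zero = paraboloid_code_combination_zero[OF small eq[unfolded code]]
  define f where "f = (\<lambda>i. \<alpha> * (x i - w i)\<^sup>2 + \<beta> * (y i - w i)\<^sup>2 + \<gamma> * (z i - w i)\<^sup>2)"
  have f: "\<alpha> * (x i)\<^sup>2 + \<beta> * (y i)\<^sup>2 + \<gamma> * (z i)\<^sup>2 - (\<alpha> + \<beta> + \<gamma>) * (w i)\<^sup>2 = f i" if "i < d" for i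
  proof -
    have "f i = \<alpha> * (x i)\<^sup>2 + \<beta> * (y i)\<^sup>2 + \<gamma> * (z i)\<^sup>2 + (\<alpha> + \<beta> + \<gamma>) * (w i)\<^sup>2
        - 2 * w i * (\<alpha> * x i + \<beta> * y i + \<gamma> * z i)"
      by (simp add: f_def power2_eq_square algebra_simps)
    also have "\<alpha> * x i + \<beta> * y i + \<gamma> * z i = (\<alpha> + \<beta> + \<gamma>) * w i" using zero(1) that by blast
    finally show ?thesis by (simp add: power2_eq_square algebra_simps)
  qed
  have "(\<Sum>i<d. f i) = 0" using zero(2) f by simp
  moreover have "\<And>i. 0 \<le> f i" using pos by (auto simp: f_def)
  ultimately have "\<forall>i<d. f i = 0" by (subst (asm) sum_nonneg_eq_0_iff) auto
  then have "x i = w i" if "i < d" for i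
  proof -
    have "\<alpha> * (x i - w i)\<^sup>2 \<le> f i" using pos by (auto simp: f_def)
    then have "\<alpha> * (x i - w i)\<^sup>2 \<le> 0" using \<open>\<forall>i<d. f i = 0\<close> that by simp
    then show ?thesis using pos by (simp add: mult_le_0_iff)
  qed
  then have "x = w" by (intro PiE_ext[OF vec(1,4)]) simp
  then show "s = v" using code by simp
qed

text \<open>Leading digit and carry-free part together are at most \<open>(d + 1) * b\<^sup>2 * (C * b) ^ d\<close>; the
  bound replaces \<open>d + 1\<close> by \<open>2 ^ d\<close> to have a pure product.\<close>

lemma paraboloid_code_bounds:
  assumes "1 \<le> C" "x \<in> digit_vectors b d" "1 \<le> b"
  shows "0 \<le> paraboloid_code (C * int b) d x"
    and "paraboloid_code (C * int b) d x < int b ^ (d + 2) * (2 * C) ^ d"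
proof -
  define B where "B = C * int b"
  have x: "0 \<le> x i \<and> x i \<le> int b - 1" if "i < d" for i
using digit_vectors_bounds[OF assms(2) that] by simp
  have Bb: "int b \<le> B" using assms by (simp add: B_def mult_le_cancel_right1)
  then have B0: "0 \<le> B" by simp
  show "0 \<le> paraboloid_code (C * int b) d x"
    unfolding paraboloid_code_def B_def[symmetric] using x B0
    by (intro add_nonneg_nonneg sum_nonneg mult_nonneg_nonneg) auto
  have "x i \<le> B - 1" if "i < d" for i
    using x[OF that] Bb by linarith
  then have "(\<Sum>i<d. x i * B ^ i) \<le> (\<Sum>i<d. (B - 1) * B ^ i)"
    using B0 by (intro sum_mono mult_right_mono) auto
  also have "\<dots> = B ^ d - 1" by (simp add: power_diff_1_eq sum_distrib_left)
  finally have low: "(\<Sum>i<d. x i * B ^ i) < B ^ d" by simp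
  have "(\<Sum>i<d. (x i)\<^sup>2) \<le> (\<Sum>i<d. (int b)\<^sup>2)"
    using x by (intro sum_mono power_mono) (simp_all add: less_imp_le)
  then have "1 + (\<Sum>i<d. (x i)\<^sup>2) \<le> (int b)\<^sup>2 + int d * (int b)\<^sup>2"
    using assms(3) by (simp add: add_mono)
  also have "\<dots> = int (d + 1) * (int b)\<^sup>2" by (simp add: algebra_simps)
  also have "\<dots> \<le> 2 ^ d * (int b)\<^sup>2"
  proof (rule mult_right_mono)
    have "Suc d \<le> 2 ^ d" using less_exp[of d] by (rule Suc_leI)
    then have "int (Suc d) \<le> int (2 ^ d)" by (rule of_nat_mono)
    then show "int (d + 1) \<le> 2 ^ d" by simp
  qed simp
  finally have "(1 + (\<Sum>i<d. (x i)\<^sup>2)) * B ^ d \<le> 2 ^ d * (int b)\<^sup>2 * B ^ d"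
    using B0 by (intro mult_right_mono) auto
  also have "\<dots> = int b ^ (d + 2) * (2 * C) ^ d"
    by (simp add: B_def power_mult_distrib power_add power2_eq_square)
  finally show "paraboloid_code (C * int b) d x < int b ^ (d + 2) * (2 * C) ^ d"
    unfolding paraboloid_code_def B_def[symmetric] using low by (simp add: algebra_simps)
qed

lemma average_free_set_exists:
  assumes "1 \<le> C" "1 \<le> b" "K * (int b ^ (d + 2) * (2 * C) ^ d) \<le> M" "0 < K"
  obtains S where "average_free C S" "finite S" "card S = b ^ d"
    "\<And>s. s \<in> S \<Longrightarrow> 0 \<le> s \<and> K * s < M"
proof
  let ?S = "paraboloid_code (C * int b) d ` digit_vectors b d"
  show "average_free C ?S" by (rule paraboloid_code_average_free)
  show "finite ?S" by (intro finite_imageI finite_PiE) auto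
  show "card ?S = b ^ d"
    using paraboloid_code_inj_on[OF assms(1), of b d]
    by (simp add: card_image card_PiE)
  show "0 \<le> s \<and> K * s < M" if "s \<in> ?S" for s
  proof -
    from that have "0 \<le> s" "s < int b ^ (d + 2) * (2 * C) ^ d"
      using paraboloid_code_bounds[OF assms(1) _ assms(2)] by auto
    moreover from this(2) have "K * s < K * (int b ^ (d + 2) * (2 * C) ^ d)"
      using assms(4) by simp
    ultimately show ?thesis using assms(3) by auto
  qed
qed

text \<open>With \<open>L = sqrt (ln n)\<close>, take base \<open>b\<close> about \<open>exp L\<close> and dimension \<open>d\<close> about \<open>L - a\<close>. Then
  \<open>b ^ d\<close> is \<open>n\<close> up to a factor \<open>exp (O(L))\<close>, and the constant \<open>a\<close> leaves room for the two extra
  factors \<open>b\<close> and for the constants \<open>C\<close> and \<open>K\<close>.\<close>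

lemma large_average_free_sets:
  assumes "1 \<le> C" "0 < K"
  obtains \<beta> :: real and n0 :: nat where "\<beta> > 0"
    "\<And>n. n0 \<le> n \<Longrightarrow> \<exists>S. average_free C S \<and> finite S \<and>
       real n * exp (- \<beta> * sqrt (ln (real n))) \<le> real (card S) \<and>
       (\<forall>s\<in>S. 0 \<le> s \<and> K * s < int n)"
proof -
  define \<kappa> where "\<kappa> = ln (real_of_int (2 * C))"
  define \<mu> where "\<mu> = ln (real_of_int K)"
  define a where "a = 2 + \<kappa> + \<mu>"
  have \<kappa>: "\<kappa> \<ge> 0" and \<mu>: "\<mu> \<ge> 0" using assms by (simp_all add: \<kappa>_def \<mu>_def)
  \<comment> \<open>from here on \<open>L \<ge> a + 1\<close>, so the dimension is positive\<close>
  define n0 where "n0 = nat \<lceil>exp ((a + 1)\<^sup>2)\<rceil>"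
  show thesis
  proof (rule that[of "a + 2" n0])
    show "a + 2 > 0" using \<kappa> \<mu> by (simp add: a_def)
  next
    fix n assume n: "n0 \<le> n"
    have "exp ((a + 1)\<^sup>2) \<le> real n" using n unfolding n0_def by linarith
    moreover have "0 < exp ((a + 1)\<^sup>2)" by simp
    ultimately have n_pos: "0 < real n" by linarith
    define L where "L = sqrt (ln (real n))"
    have "(a + 1)\<^sup>2 \<le> ln (real n)"
      using \<open>exp ((a + 1)\<^sup>2) \<le> real n\<close> n_pos by (simp add: ln_ge_iff)
    then have L: "a + 1 \<le> L" unfolding L_def by (rule real_le_rsqrt)
    have "0 \<le> ln (real n)" using \<open>(a + 1)\<^sup>2 \<le> ln (real n)\<close> zero_le_power2 order_trans by blast
    then have nL: "real n = exp (L\<^sup>2)" using n_pos by (simp add: L_def)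
    define b where "b = nat \<lfloor>exp L\<rfloor>"
    define d where "d = nat \<lfloor>L - a\<rfloor>"
    have L1: "1 \<le> L" and L2: "2 \<le> L" using L \<kappa> \<mu> by (auto simp: a_def)
    have d_le: "real d \<le> L - a" and d_ge: "L - a - 1 \<le> real d"
      using L unfolding d_def by linarith+
    have b_le: "real b \<le> exp L" unfolding b_def by simp
    have "exp L - 1 \<le> real b" unfolding b_def by linarith
    moreover have "exp (L - 1) \<le> exp L - 1"
    proof -
      have "1 \<le> exp (L - 1)" "2 \<le> exp (1 :: real)" using L1 exp_ge_add_one_self[of 1] by auto
      moreover from this have "2 * exp (L - 1) \<le> exp 1 * exp (L - 1)" by (intro mult_right_mono) auto
      moreover have "exp 1 * exp (L - 1) = exp L" by (simp add: exp_add[symmetric])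
      ultimately show ?thesis by linarith
    qed
    ultimately have b_ge: "exp (L - 1) \<le> real b" by linarith
    have b1: "1 \<le> b"
    proof -
      have "0 < real b" using b_ge exp_gt_zero[of "L - 1"] by linarith
      then show ?thesis by simp
    qed
    have "real_of_int (K * (int b ^ (d + 2) * (2 * C) ^ d))
        = exp \<mu> * (real b ^ (d + 2) * exp \<kappa> ^ d)"
      using assms by (simp add: \<mu>_def \<kappa>_def)
    also have "\<dots> \<le> exp \<mu> * (exp L ^ (d + 2) * exp \<kappa> ^ d)"
      using b_le by (intro mult_left_mono mult_right_mono power_mono) auto
    also have "\<dots> = exp (\<mu> + L * real (d + 2) + \<kappa> * real d)"
      unfolding exp_add exp_of_nat2_mult by (simp only: ac_simps)
    also have "\<dots> \<le> exp (L\<^sup>2)"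
    proof -
      have "\<mu> * 1 \<le> \<mu> * L" using \<mu> L1 by (intro mult_left_mono) auto
      moreover have "\<kappa> * real d \<le> \<kappa> * L" using \<kappa> \<mu> d_le by (intro mult_left_mono) (auto simp: a_def)
      moreover have "L * real (d + 2) \<le> L * (L - a + 2)" using d_le L1 by (intro mult_left_mono) auto
      ultimately show ?thesis by (simp add: a_def algebra_simps power2_eq_square)
    qed
    finally have size: "K * (int b ^ (d + 2) * (2 * C) ^ d) \<le> int n"
      using nL by (metis of_int_le_iff of_int_of_nat_eq)
    obtain S where S: "average_free C S" "finite S" "card S = b ^ d"
      "\<And>s. s \<in> S \<Longrightarrow> 0 \<le> s \<and> K * s < int n"
      using average_free_set_exists[OF assms(1) b1 size assms(2)] by blast
    have "real n * exp (- (a + 2) * sqrt (ln (real n))) = exp (L\<^sup>2 - (a + 2) * L)"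
      unfolding L_def[symmetric] by (simp add: nL exp_add[symmetric] algebra_simps)
    also have "\<dots> \<le> exp ((L - 1) * real d)"
    proof -
      have "(L - 1) * (L - a - 1) \<le> (L - 1) * real d" using d_ge L1 by (intro mult_left_mono) auto
      moreover have "L\<^sup>2 - (a + 2) * L \<le> (L - 1) * (L - a - 1)"
        using \<kappa> \<mu> by (simp add: a_def algebra_simps power2_eq_square)
      ultimately show ?thesis by simp
    qed
    also have "\<dots> = exp (L - 1) ^ d" by (simp add: exp_of_nat2_mult)
    also have "\<dots> \<le> real b ^ d" using b_ge by (intro power_mono) auto
    finally have "real n * exp (- (a + 2) * sqrt (ln (real n))) \<le> real (card S)" using S(3) by simp
    then show "\<exists>S. average_free C S \<and> finite S \<and>
       real n * exp (- (a + 2) * sqrt (ln (real n))) \<le> real (card S) \<and>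
       (\<forall>s\<in>S. 0 \<le> s \<and> K * s < int n)"
      using S by blast
  qed
qed

section \<open>Two combinatorial facts modulo r\<close>

text \<open>Nothing lies above \<open>r - 1\<close>, so \<open>\<sigma> (r - 1) = 0\<close>; every other value is then larger than its
  argument, and an injective map of this kind can only move up by one.\<close>

lemma successor_permutation:
  fixes \<sigma> :: "nat \<Rightarrow> nat"
  assumes "3 \<le> r" "inj_on \<sigma> {..<r}" "\<sigma> ` {..<r} \<subseteq> {..<r}" "\<sigma> 0 = 1"
    and step: "\<And>g. 2 \<le> g \<Longrightarrow> g < r \<Longrightarrow> \<sigma> g = 0 \<or> g < \<sigma> g"
  shows "g < r \<Longrightarrow> \<sigma> g = (g + 1) mod r"
proof -
  have range: "\<sigma> g < r" if "g < r" for g using assms(3) that by auto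
  have last: "\<sigma> (r - 1) = 0" using step[of "r - 1"] range[of "r - 1"] assms(1) by linarith
  have up: "g < \<sigma> g" if "g + 1 < r" for g
  proof -
    have "\<sigma> g \<noteq> 0"
    proof
      assume "\<sigma> g = 0"
      then have "g = r - 1" using inj_onD[OF assms(2), of g "r - 1"] last that by simp
      then show False using that by simp
    qed
    have "\<sigma> 1 \<noteq> 1" using inj_onD[OF assms(2), of 0 1] assms(1,4) by auto
    consider "g = 0" | "g = 1" | "2 \<le> g" by linarith
    then show ?thesis
    proof cases
      case 1
      then show ?thesis using assms(4) by simp
    next
      case 2
      then show ?thesis using \<open>\<sigma> g \<noteq> 0\<close> \<open>\<sigma> 1 \<noteq> 1\<close> by simp
    next
      case 3
      then show ?thesis using step[of g] \<open>\<sigma> g \<noteq> 0\<close> that by simp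
    qed
  qed
  have "g + 1 < r \<Longrightarrow> \<sigma> g = g + 1" for g
  proof (induction "r - g" arbitrary: g rule: less_induct)
    case less
    show ?case
    proof (rule ccontr)
      assume "\<sigma> g \<noteq> g + 1"
      then have g: "g + 1 < \<sigma> g" using up[OF less.prems] by simp
      moreover have "\<sigma> g < r" using range less.prems by simp
      ultimately have "\<sigma> (\<sigma> g - 1) = \<sigma> g" using less.hyps[of "\<sigma> g - 1"] by auto
      then have "\<sigma> g - 1 = g"
        using inj_onD[OF assms(2), of "\<sigma> g - 1" g] \<open>\<sigma> g < r\<close> less.prems by auto
      then show False using g by simp
    qed
  qed
  then show "g < r \<Longrightarrow> \<sigma> g = (g + 1) mod r"
    using last by (cases "g + 1 < r") (auto simp: less_Suc_eq_le not_less le_less_Suc_eq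
        dest!: le_antisym)
qed

lemma residue_completion:
  fixes i g r :: nat
  assumes "g < r"
  obtains j where "j < r" "(i + j) mod r = g"
proof
  show "(g + (r - i mod r)) mod r < r" using assms by simp
  have "(i + (g + (r - i mod r)) mod r) mod r = (i mod r + (g + (r - i mod r))) mod r"
    by (simp add: mod_simps)
  also have "i mod r + (g + (r - i mod r)) = g + r"
    using assms mod_less_divisor[of r i] by linarith
  finally show "(i + (g + (r - i mod r)) mod r) mod r = g" using assms by simp
qed

section \<open>Lines and their crossings\<close>

text \<open>The constant \<open>9 * r\<^sup>2\<close> exceeds the total loss \<open>8 * r\<^sup>2 + 2 * r\<close> of the two chains of crossings
  in the proof of \<open>no_cyclic_grid\<close>.\<close>

definition slope_factor :: "nat \<Rightarrow> nat \<Rightarrow> int" where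
  "slope_factor r i = (if i < 2 then int i else int (9 * r\<^sup>2 + i))"

definition slope_bound :: "nat \<Rightarrow> int" where
  "slope_bound r = int (9 * r\<^sup>2 + r)"

lemma slope_factor_less: "i < j \<Longrightarrow> slope_factor r i < slope_factor r j"
  by (cases "i < 2"; cases "j < 2") (auto simp: slope_factor_def simp del: of_nat_add of_nat_mult)

lemma slope_factor_le: "i \<le> j \<Longrightarrow> slope_factor r i \<le> slope_factor r j"
  using slope_factor_less[of i j r] by (cases "i = j") auto

lemma slope_factor_nonneg: "0 \<le> slope_factor r i"
  by (auto simp: slope_factor_def)

lemma slope_factor_le_bound: "i < r \<Longrightarrow> slope_factor r i \<le> slope_bound r"
  unfolding slope_factor_def slope_bound_def by (simp del: of_nat_add of_nat_mult)

lemma dvd_small_imp_zero: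
  fixes x m :: int
  assumes "m dvd x" "\<bar>x\<bar> < m"
  shows "x = 0"
  using assms dvd_imp_le_int[of x m] by auto

text \<open>The factor \<open>2\<close> in the size condition leaves room for the sum of two terms to be small
  modulo \<open>m\<close>, so that congruences between slopes are equations.\<close>

locale line_system =
  fixes r m :: nat and S :: "int set"
  assumes r: "4 \<le> r"
    and S_nonneg: "s \<in> S \<Longrightarrow> 0 \<le> s"
    and S_small: "s \<in> S \<Longrightarrow> 2 * slope_bound r * s < int m"
    and S_average_free: "average_free (slope_bound r) S"
    and S_finite: "finite S"
    and m_pos: "0 < m"
begin

abbreviation c :: "nat \<Rightarrow> int" where "c \<equiv> slope_factor r"

definition Lines :: "(int \<times> int) set" where
  "Lines = {0..<int m} \<times> S"

definition meet :: "nat \<Rightarrow> int \<times> int \<Rightarrow> int \<times> int \<Rightarrow> bool" where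
  "meet i l l' \<longleftrightarrow> int m dvd (fst l + c i * snd l) - (fst l' + c i * snd l')"

lemma meet_refl [simp]: "meet i l l"
  by (simp add: meet_def)

lemma meet_sym: "meet i l l' \<Longrightarrow> meet i l' l"
  unfolding meet_def by (subst dvd_minus_iff[symmetric]) simp

lemma meet_trans: "meet i l l' \<Longrightarrow> meet i l' l'' \<Longrightarrow> meet i l l''"
  unfolding meet_def by (drule (1) dvd_add) (simp add: algebra_simps)

lemma finite_Lines: "finite Lines"
  by (simp add: Lines_def S_finite)

lemma LinesD: "l \<in> Lines \<Longrightarrow> snd l \<in> S" "l \<in> Lines \<Longrightarrow> 0 \<le> fst l" "l \<in> Lines \<Longrightarrow> fst l < int m"
  by (auto simp: Lines_def)

lemma slope_product_small:
  assumes "s \<in> S" "t \<in> S" "0 \<le> k" "k \<le> slope_bound r"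
  shows "2 * \<bar>k * (s - t)\<bar> < int m"
proof -
  define u where "u = max s t"
  have u: "u \<in> S" using assms by (simp add: u_def max_def)
  have "\<bar>s - t\<bar> \<le> u" using S_nonneg[OF assms(1)] S_nonneg[OF assms(2)] by (simp add: u_def)
  then have "\<bar>k * (s - t)\<bar> \<le> slope_bound r * u"
    unfolding abs_mult using assms by (intro mult_mono) auto
  then show ?thesis using S_small[OF u] by linarith
qed

lemma parallel_meet_eq:
  assumes "l \<in> Lines" "l' \<in> Lines" "meet i l l'" "snd l = snd l'"
  shows "l = l'"
proof -
  have "int m dvd fst l - fst l'" using assms(3,4) by (simp add: meet_def)
  moreover have "\<bar>fst l - fst l'\<bar> < int m" 
    using LinesD(2,3)[OF assms(1)] LinesD(2,3)[OF assms(2)] by linarith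
  ultimately have "fst l - fst l' = 0" by (rule dvd_small_imp_zero)
  then show ?thesis using assms(4) by (simp add: prod_eq_iff)
qed

lemma meet_twice_eq_aux:
  assumes l: "l \<in> Lines" "l' \<in> Lines" and "meet i l l'" "meet j l l'" "i < j" "j < r"
  shows "l = l'"
proof -
  have "int m dvd (c j - c i) * (snd l - snd l')"
  proof -
    have "(c j - c i) * (snd l - snd l') = ((fst l + c j * snd l) - (fst l' + c j * snd l'))
      - ((fst l + c i * snd l) - (fst l' + c i * snd l'))" by (simp add: algebra_simps)
    then show ?thesis
      using dvd_diff[OF \<open>meet j l l'\<close>[unfolded meet_def] \<open>meet i l l'\<close>[unfolded meet_def]]
      by simp
  qed
  moreover have "2 * \<bar>(c j - c i) * (snd l - snd l')\<bar> < int m"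
    using l LinesD(1) slope_factor_less[OF \<open>i < j\<close>, of r] slope_factor_le_bound[OF \<open>j < r\<close>]
      slope_factor_nonneg[of r i]
    by (intro slope_product_small) auto
  ultimately have "(c j - c i) * (snd l - snd l') = 0" by (intro dvd_small_imp_zero) auto
  then have "snd l = snd l'" using slope_factor_less[OF \<open>i < j\<close>, of r] by simp
  then show ?thesis using parallel_meet_eq assms by blast
qed

lemma meet_twice_eq:
  assumes "l \<in> Lines" "l' \<in> Lines" "meet i l l'" "meet j l l'" "i \<noteq> j" "i < r" "j < r"
  shows "l = l'"
proof (cases "i < j")
  case True
  then show ?thesis using meet_twice_eq_aux[OF assms(1-4)] assms(7) by simp
next
  case False
  then show ?thesis using meet_twice_eq_aux[OF assms(1,2,4,3)] assms(5,6) by simp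
qed

text \<open>Adding up the four crossings eliminates the positions and leaves
  \<open>(c b - c a) * p + (c d - c b) * q + (c e - c d) * u = (c e - c a) * v\<close> for the slopes: \<open>v\<close> is a
  weighted average of the other three. The cases \<open>b = d\<close> and \<open>d = e\<close> are allowed so that triangles,
  with one side repeated, are included.\<close>

lemma no_monotone_quadrilateral:
  assumes lines: "p \<in> Lines" "q \<in> Lines" "u \<in> Lines" "v \<in> Lines"
    and meets: "meet b p q" "meet d q u" "meet e u v" "meet a v p"
    and order: "a < b" "b \<le> d" "d \<le> e" "e < r"
  shows "p = v"
proof -
  let ?lhs = "(c b - c a) * snd p + (c d - c b) * snd q + (c e - c d) * snd u"
  let ?rhs = "((c b - c a) + (c d - c b) + (c e - c d)) * snd v"
  define t where "t = max (snd p) (max (snd q) (max (snd u) (snd v)))"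
  have tS: "t \<in> S" using lines LinesD(1) by (auto simp: t_def max_def)
  have nonneg: "0 < c b - c a" "0 \<le> c d - c b" "0 \<le> c e - c d"
    using slope_factor_less[of a b r] slope_factor_le[of b d r] slope_factor_le[of d e r] order by auto
  have bound: "c e - c a \<le> slope_bound r"
    using slope_factor_le_bound[of e r] slope_factor_nonneg[of r a] order by auto
  have le: "snd p \<le> t" "snd q \<le> t" "snd u \<le> t" "snd v \<le> t" by (auto simp: t_def)
  have ge: "0 \<le> snd p" "0 \<le> snd q" "0 \<le> snd u" "0 \<le> snd v"
    using lines LinesD(1) S_nonneg by blast+
  have "int m dvd ?lhs - ?rhs"
  proof -
    have "?lhs - ?rhs = ((fst p + c b * snd p) - (fst q + c b * snd q))
        + ((fst q + c d * snd q) - (fst u + c d * snd u))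
        + ((fst u + c e * snd u) - (fst v + c e * snd v))
        + ((fst v + c a * snd v) - (fst p + c a * snd p))"
      by (simp add: algebra_simps)
    moreover have "int m dvd \<dots>"
      using meets unfolding meet_def by (intro dvd_add)
    ultimately show ?thesis by (simp only:)
  qed
  moreover have "\<bar>?lhs - ?rhs\<bar> < int m"
  proof -
    have "(c b - c a) * snd p \<le> (c b - c a) * t" "(c d - c b) * snd q \<le> (c d - c b) * t"
      "(c e - c d) * snd u \<le> (c e - c d) * t"
      using nonneg le by (auto intro!: mult_left_mono)
    then have "?lhs \<le> (c e - c a) * t" by (simp add: algebra_simps)
    moreover have "?rhs \<le> (c e - c a) * t"
      using nonneg le by (simp add: mult_left_mono)
    moreover have "0 \<le> ?lhs" "0 \<le> ?rhs" using nonneg ge by (auto intro!: add_nonneg_nonneg)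
    moreover have "(c e - c a) * t \<le> slope_bound r * t"
      using bound S_nonneg[OF tS] by (rule mult_right_mono)
    moreover have "0 \<le> slope_bound r * t" using S_nonneg[OF tS] by (simp add: slope_bound_def)
    ultimately show ?thesis using S_small[OF tS] by linarith
  qed
  ultimately have "?lhs - ?rhs = 0" by (rule dvd_small_imp_zero)
  then have "snd p = snd v"
    using nonneg bound
    by (intro average_freeD[OF S_average_free lines[THEN LinesD(1)],
          of "c b - c a" "c d - c b" "c e - c d"]) auto
  then show ?thesis using parallel_meet_eq[of p v a] lines meets(4) meet_sym by blast
qed

lemma no_sorted_triangle:
  assumes "p \<in> Lines" "q \<in> Lines" "v \<in> Lines"
    "meet b p q" "meet e q v" "meet a v p" "a < b" "b < e" "e < r"
  shows "p = v"
  using no_monotone_quadrilateral[of p q q v b b e a] assms by auto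

lemma no_triangle:
  assumes l: "l1 \<in> Lines" "l2 \<in> Lines" "l3 \<in> Lines"
    and m: "meet i l1 l2" "meet j l2 l3" "meet k l1 l3"
    and lt: "i < r" "j < r" "k < r" and ne: "i \<noteq> j" "j \<noteq> k" "i \<noteq> k"
  shows "l1 = l2 \<or> l2 = l3 \<or> l1 = l3"
proof -
  note m' = m[THEN meet_sym]
  consider "i < j" "j < k" | "i < k" "k < j" | "j < i" "i < k" | "j < k" "k < i"
    | "k < i" "i < j" | "k < j" "j < i"
    using ne by linarith
  then show ?thesis
  proof cases
    case 1 then show ?thesis using no_sorted_triangle[OF l(2,3,1) m(2) m'(3) m(1)] lt by simp
  next
    case 2 then show ?thesis using no_sorted_triangle[OF l(1,3,2) m(3) m'(2) m'(1)] lt by simp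
  next
    case 3 then show ?thesis using no_sorted_triangle[OF l(2,1,3) m'(1) m(3) m'(2)] lt by simp
  next
    case 4 then show ?thesis using no_sorted_triangle[OF l(3,1,2) m'(3) m(1) m(2)] lt by simp
  next
    case 5 then show ?thesis using no_sorted_triangle[OF l(1,2,3) m(1) m(2) m'(3)] lt by simp
  next
    case 6 then show ?thesis using no_sorted_triangle[OF l(3,2,1) m'(2) m'(1) m(3)] lt by simp
  qed
qed

section \<open>Grids\<close>

definition grid :: "(int \<times> int) set \<Rightarrow> (int \<times> int) set \<Rightarrow> bool" where
  "grid \<A> \<B> \<longleftrightarrow> \<A> \<subseteq> Lines \<and> \<B> \<subseteq> Lines \<and> \<A> \<inter> \<B> = {} \<and>
     (\<forall>a\<in>\<A>. \<forall>g<r. \<exists>!b. b \<in> \<B> \<and> meet g a b) \<and>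
     (\<forall>b\<in>\<B>. \<forall>g<r. \<exists>!a. a \<in> \<A> \<and> meet g a b) \<and>
     (\<forall>a\<in>\<A>. \<forall>b\<in>\<B>. \<exists>!g. g < r \<and> meet g a b)"

text \<open>Compare the rows \<open>a\<close> and \<open>a'\<close> through the permutation \<open>\<sigma>\<close> of the colours that sends the colour of
  \<open>a\<close> in a column to the colour of \<open>a'\<close> there. If \<open>1 < \<sigma> g < g\<close>, then the column with colours \<open>g\<close> and
  \<open>\<sigma> g\<close> together with the column \<open>b0\<close> with colours \<open>0\<close> and \<open>1\<close> gives a monotone quadrilateral. So
  \<open>\<sigma>\<close> satisfies the assumptions of \<open>successor_permutation\<close>.\<close>

lemma grid_row_shift:
  assumes G: "grid \<A> \<B>" and a: "a \<in> \<A>" "a' \<in> \<A>" and b0: "b0 \<in> \<B>" "meet 0 a b0" "meet 1 a' b0"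
    and b: "b \<in> \<B>" "g < r" "meet g a b"
  shows "meet ((g + 1) mod r) a' b"
proof -
  have lines: "\<A> \<subseteq> Lines" "\<B> \<subseteq> Lines" "\<A> \<inter> \<B> = {}"
    and ex_b: "\<And>a g. a \<in> \<A> \<Longrightarrow> g < r \<Longrightarrow> \<exists>!b. b \<in> \<B> \<and> meet g a b"
    and ex_a: "\<And>b g. b \<in> \<B> \<Longrightarrow> g < r \<Longrightarrow> \<exists>!a. a \<in> \<A> \<and> meet g a b"
    and ex_g: "\<And>a b. a \<in> \<A> \<Longrightarrow> b \<in> \<B> \<Longrightarrow> \<exists>!g. g < r \<and> meet g a b"
    using G unfolding grid_def by auto
  have r01: "0 < r" "1 < r" using r by auto
  have "a \<noteq> a'"
  proof
    assume "a = a'"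
    then have "meet 0 a b0 \<and> meet 1 a b0" using b0 by simp
    then show False using ex_g[OF a(1) b0(1)] r01 by (metis zero_neq_one)
  qed
  obtain col where col: "\<And>g. g < r \<Longrightarrow> col g \<in> \<B> \<and> meet g a (col g)"
    using ex_b[OF a(1)] by metis
  obtain \<sigma> where \<sigma>: "\<And>g. g < r \<Longrightarrow> \<sigma> g < r \<and> meet (\<sigma> g) a' (col g)"
  proof -
    have "\<forall>g. \<exists>h. g < r \<longrightarrow> h < r \<and> meet h a' (col g)" using ex_g[OF a(2)] col by blast
    then show ?thesis using that by metis
  qed
  have col_unique: "col g = b" if "b \<in> \<B>" "meet g a b" "g < r" for b g
    using ex_b[OF a(1) that(3)] col[OF that(3)] that by blast
  have inj: "inj_on \<sigma> {..<r}"
  proof (rule inj_onI)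
    fix g h assume "g \<in> {..<r}" "h \<in> {..<r}" and eq: "\<sigma> g = \<sigma> h"
    then have gh: "g < r" "h < r" by auto
    have "col g = col h"
      using ex_b[OF a(2), of "\<sigma> g"] \<sigma>[OF gh(1)] \<sigma>[OF gh(2)] col[OF gh(1)] col[OF gh(2)] eq by metis
    then show "g = h"
      using ex_g[OF a(1), of "col g"] col[OF gh(1)] col[OF gh(2)] gh by metis
  qed
  have col0: "col 0 = b0" using col_unique b0 r01 by blast
  have \<sigma>0: "\<sigma> 0 = 1"
    using ex_g[OF a(2) b0(1)] \<sigma>[OF r01(1)] b0(3) r01(2) col0 by metis
  have "\<sigma> g = 0 \<or> g < \<sigma> g" if g: "2 \<le> g" "g < r" for g
  proof (rule ccontr)
    assume neg: "\<not> (\<sigma> g = 0 \<or> g < \<sigma> g)"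
    have "\<sigma> g \<noteq> g"
    proof
      assume "\<sigma> g = g"
      then have "meet g a' (col g)" using \<sigma>[OF g(2)] by simp
      then show False using ex_a[of "col g" g] col[OF g(2)] a g(2) \<open>a \<noteq> a'\<close> by metis
    qed
    moreover have "\<sigma> g \<noteq> 1" using inj_onD[OF inj, of g 0] \<sigma>0 g by auto
    \<comment> \<open>the sides \<open>b0\<close>, \<open>a'\<close>, column of \<open>g\<close>, \<open>a\<close> have corners of colours \<open>0 < 1 < \<sigma> g < g\<close>\<close>
    ultimately have "1 \<le> \<sigma> g" "\<sigma> g \<le> g" using neg by auto
    then have "b0 = a"
      using no_monotone_quadrilateral[of b0 a' "col g" a 1 "\<sigma> g" g 0]
        lines a b0 col[OF g(2)] \<sigma>[OF g(2)] g meet_sym by auto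
    then show False using lines(3) a b0 by blast
  qed
  then have "\<sigma> g = (g + 1) mod r"
    using successor_permutation[OF _ inj _ \<sigma>0] \<sigma> b(2) r by fastforce
  then show ?thesis using \<sigma>[OF b(2)] col_unique[OF b(1,3,2)] by simp
qed

text \<open>From any row, pass to the row that has colour \<open>1\<close> where the current one has colour \<open>0\<close>; each
  such step shifts all colours by one.\<close>

lemma grid_cyclic:
  assumes G: "grid \<A> \<B>" and "\<A> \<noteq> {}"
  obtains A B where "\<And>i. A i \<in> \<A>" "\<And>j. j < r \<Longrightarrow> B j \<in> \<B>"
    "\<And>i j. j < r \<Longrightarrow> meet ((i + j) mod r) (A i) (B j)"
proof -
  have ex_b: "\<exists>b. b \<in> \<B> \<and> meet g a b" if "a \<in> \<A>" "g < r" for a g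
    using G that unfolding grid_def by (elim conjE) (rule ex1_implies_ex, simp)
  have ex_a: "\<exists>a. a \<in> \<A> \<and> meet g a b" if "b \<in> \<B>" "g < r" for b g
    using G that unfolding grid_def by (elim conjE) (rule ex1_implies_ex, simp)
  have r01: "0 < r" "1 < r" using r by auto
  have "\<exists>a'\<in>\<A>. \<exists>b\<in>\<B>. meet 0 a b \<and> meet 1 a' b" if "a \<in> \<A>" for a
    using ex_b[OF that r01(1)] ex_a[OF _ r01(2)] by blast
  then obtain succ where succ: "\<And>a. a \<in> \<A> \<Longrightarrow> succ a \<in> \<A>"
      "\<And>a. a \<in> \<A> \<Longrightarrow> \<exists>b\<in>\<B>. meet 0 a b \<and> meet 1 (succ a) b"
    by metis
  obtain a0 where a0: "a0 \<in> \<A>" using assms(2) by blast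
  obtain B where B: "\<And>j. j < r \<Longrightarrow> B j \<in> \<B> \<and> meet j a0 (B j)"
    using ex_b[OF a0] by metis
  have A: "(succ ^^ i) a0 \<in> \<A>" for i
    by (induction i) (use a0 succ(1) in auto)
  show thesis
  proof (rule that)
    show "meet ((i + j) mod r) ((succ ^^ i) a0) (B j)" if "j < r" for i j
    proof (induction i)
      case 0
      then show ?case using B that by simp
    next
      case (Suc i)
      obtain b where b: "b \<in> \<B>" "meet 0 ((succ ^^ i) a0) b" "meet 1 (succ ((succ ^^ i) a0)) b"
        using succ(2)[OF A] by blast
      have "meet (((i + j) mod r + 1) mod r) (succ ((succ ^^ i) a0)) (B j)"
        using grid_row_shift[OF G A succ(1)[OF A] b _ _ Suc.IH] B[OF that] r01 by simp
      then show ?case by (simp add: mod_simps)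
    qed
  qed (use A B in auto)
qed

text \<open>Let \<open>D\<close> be the largest difference between a slope of some \<open>A i\<close> and a slope of some \<open>B j\<close>. Since
  \<open>c 0 = 0\<close> and \<open>c 1 = 1\<close>, a step from \<open>A i\<close> to \<open>A (i + 1)\<close> through crossings of colours \<open>0\<close> and \<open>1\<close>
  moves the position by at most \<open>D\<close>, so all positions agree up to \<open>2 * r * D\<close> modulo \<open>m\<close>. At a
  crossing of colour \<open>g \<ge> 2\<close>, where \<open>c g \<ge> N = 9 * r\<^sup>2\<close>, the slopes then differ by at most
  \<open>2 * r * D / N\<close>, and chaining crossings
  of colours \<open>2\<close> and \<open>3\<close> bounds \<open>D\<close> by \<open>(8 * r\<^sup>2 + 2 * r) * D / N\<close>, which is less than \<open>D\<close> unless
  \<open>D = 0\<close>.\<close>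

lemma no_cyclic_grid:
  assumes A: "\<And>i. A i \<in> Lines" and B: "\<And>j. j < r \<Longrightarrow> B j \<in> Lines"
    and meets: "\<And>i j. j < r \<Longrightarrow> meet ((i + j) mod r) (A i) (B j)"
  shows "A 0 = B 0"
proof -
  define s t where "s = (\<lambda>i. snd (A i))" and "t = (\<lambda>j. snd (B j))"
  define x y where "x = (\<lambda>i. fst (A i))" and "y = (\<lambda>j. fst (B j))"
  have sS: "s i \<in> S" for i using LinesD(1)[OF A] by (simp add: s_def)
  have tS: "t j \<in> S" if "j < r" for j using LinesD(1)[OF B[OF that]] by (simp add: t_def)
  have cross: "int m dvd (x i + c g * s i) - (y j + c g * t j)" if "j < r" "(i + j) mod r = g" for i j g
    using meets[OF that(1), of i] that(2) by (simp add: meet_def x_def y_def s_def t_def)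
  define gaps where "gaps = (\<lambda>(i, j). \<bar>t j - s i\<bar>) ` ({..<r} \<times> {..<r})"
  define D where "D = Max gaps"
  have "finite gaps" "gaps \<noteq> {}" using r by (auto simp: gaps_def lessThan_empty_iff)
  then have "D \<in> gaps" unfolding D_def by (rule Max_in)
  then obtain i1 j1 where D: "D = \<bar>t j1 - s i1\<bar>" "i1 < r" "j1 < r" by (auto simp: gaps_def)
  have gap_le: "\<bar>t j - s i\<bar> \<le> D" if "i < r" "j < r" for i j
    unfolding D_def by (rule Max_ge[OF \<open>finite gaps\<close>]) (use that in \<open>force simp: gaps_def\<close>)
  have D0: "0 \<le> D" using D by simp
  have c01: "c 0 = 0" "c 1 = 1" by (simp_all add: slope_factor_def)
  have near_x: "\<exists>w. \<bar>w\<bar> \<le> int i * D \<and> int m dvd x i - x 0 - w" if "i < r" for i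
    using that
  proof (induction i)
    case 0
    then show ?case by (intro exI[of _ 0]) simp
  next
    case (Suc i)
    then obtain w where w: "\<bar>w\<bar> \<le> int i * D" "int m dvd x i - x 0 - w" by auto
    obtain j where j: "j < r" "(i + j) mod r = 0" using residue_completion[of 0 r i] r by auto
    have "(Suc i + j) mod r = Suc ((i + j) mod r) mod r" by (simp add: mod_simps)
    then have "(Suc i + j) mod r = 1" using j(2) r by simp
    from cross[OF j(1) this] cross[OF j]
    have "int m dvd x (Suc i) + s (Suc i) - (y j + t j)" "int m dvd x i - y j"
      by (simp_all only: c01 mult_1 mult_zero_left add_0_right)
    from dvd_add[OF dvd_diff[OF this] w(2)]
    have "int m dvd x (Suc i) - x 0 - (w + (t j - s (Suc i)))" by (simp add: algebra_simps)
    moreover have "\<bar>w + (t j - s (Suc i))\<bar> \<le> int (Suc i) * D"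
      using w(1) gap_le[OF Suc.prems j(1)] by (simp add: algebra_simps)
    ultimately show ?case by blast
  qed
  have near_xy: "\<exists>w. \<bar>w\<bar> \<le> 2 * int r * D \<and> int m dvd x i - y j - w" if "i < r" "j < r" for i j
  proof -
    obtain i0 where i0: "i0 < r" "(j + i0) mod r = 0" using residue_completion[of 0 r j] r by auto
    obtain w where w: "\<bar>w\<bar> \<le> int i * D" "int m dvd x i - x 0 - w" using near_x \<open>i < r\<close> by blast
    obtain w0 where w0: "\<bar>w0\<bar> \<le> int i0 * D" "int m dvd x i0 - x 0 - w0" using near_x i0 by blast
    have "int m dvd x i0 - y j" using cross[OF \<open>j < r\<close>, of i0 0] i0 by (simp add: c01 add.commute)
    from dvd_add[OF dvd_diff[OF w(2) w0(2)] this]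
    have "int m dvd x i - y j - (w - w0)" by (simp add: algebra_simps)
    moreover have "int i * D \<le> int r * D" "int i0 * D \<le> int r * D"
      using \<open>i < r\<close> i0 D0 by (auto intro!: mult_right_mono)
    then have "\<bar>w - w0\<bar> \<le> 2 * int r * D" using w(1) w0(1) by linarith
    ultimately show ?thesis by blast
  qed
  define N where "N = int (9 * r\<^sup>2)"
  have steep: "N * \<bar>t j - s i\<bar> \<le> 2 * int r * D"
    if ij: "i < r" "j < r" "(i + j) mod r = g" "2 \<le> g" "g < r" for i j g
  proof -
    obtain w where w: "\<bar>w\<bar> \<le> 2 * int r * D" "int m dvd x i - y j - w"
      using near_xy[OF ij(1,2)] by metis
    from dvd_diff[OF w(2) cross[OF ij(2,3)]]
    have "int m dvd c g * (t j - s i) - w" by (simp add: algebra_simps)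
    moreover have "\<bar>c g * (t j - s i) - w\<bar> < int m"
    proof -
      have "2 * \<bar>c g * (t j - s i)\<bar> < int m"
        using slope_factor_nonneg slope_factor_le_bound ij sS tS
        by (intro slope_product_small) auto
      moreover have "2 * \<bar>2 * int r * (t j1 - s i1)\<bar> < int m"
      proof (rule slope_product_small)
        have "r * 2 \<le> r * r" using r by (intro mult_left_mono) auto
        then show "2 * int r \<le> slope_bound r"
          unfolding slope_bound_def power2_eq_square by linarith
      qed (use sS tS D in auto)
      then have "2 * (2 * int r * D) < int m" using D(1) by (simp add: abs_mult)
      ultimately show ?thesis using w(1) by linarith
    qed
    ultimately have "c g * (t j - s i) - w = 0" by (rule dvd_small_imp_zero)
    then have "c g * \<bar>t j - s i\<bar> = \<bar>w\<bar>"
      using slope_factor_nonneg[of r g] by (metis abs_mult abs_of_nonneg eq_iff_diff_eq_0)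
    moreover have "N * \<bar>t j - s i\<bar> \<le> c g * \<bar>t j - s i\<bar>"
      using ij by (intro mult_right_mono) (auto simp: N_def slope_factor_def)
    ultimately show ?thesis using w(1) by linarith
  qed
  have N0: "0 \<le> N" by (simp add: N_def)
  have s_near: "N * \<bar>s i - s 0\<bar> \<le> int i * (4 * int r * D)" if "i < r" for i
    using that
  proof (induction i)
    case 0
    then show ?case by simp
  next
    case (Suc i)
    obtain j where j: "j < r" "(i + j) mod r = 2" using residue_completion[of 2 r i] r by auto
    have "(Suc i + j) mod r = Suc ((i + j) mod r) mod r" by (simp add: mod_simps)
    then have j': "(Suc i + j) mod r = 3" using j(2) r by simp
    have "N * \<bar>t j - s i\<bar> \<le> 2 * int r * D" "N * \<bar>t j - s (Suc i)\<bar> \<le> 2 * int r * D"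
      using steep[OF _ j] steep[OF _ j(1) j'] r Suc.prems by auto
    moreover have "N * \<bar>s i - s 0\<bar> \<le> int i * (4 * int r * D)" using Suc by simp
    moreover have "N * \<bar>s (Suc i) - s 0\<bar>
        \<le> N * (\<bar>t j - s i\<bar> + \<bar>t j - s (Suc i)\<bar> + \<bar>s i - s 0\<bar>)"
      using N0 by (intro mult_left_mono) auto
    ultimately show ?case by (simp add: algebra_simps)
  qed
  have bound_s: "N * \<bar>s i - s 0\<bar> \<le> 4 * (int r)\<^sup>2 * D" if "i < r" for i
  proof -
    have "int i * (4 * int r * D) \<le> int r * (4 * int r * D)"
      using that D0 by (intro mult_right_mono) auto
    then show ?thesis using s_near[OF that] by (simp add: power2_eq_square algebra_simps)
  qed
  obtain i2 where i2: "i2 < r" "(j1 + i2) mod r = 2" using residue_completion[of 2 r j1] r by auto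
  have "N * \<bar>t j1 - s i2\<bar> \<le> 2 * int r * D"
    using steep[OF i2(1) D(3), of 2] i2(2) r by (simp add: add.commute)
  moreover have "N * D \<le> N * (\<bar>t j1 - s i2\<bar> + \<bar>s i2 - s 0\<bar> + \<bar>s i1 - s 0\<bar>)"
    using N0 D(1) by (intro mult_left_mono) auto
  ultimately have "N * D \<le> 2 * int r * D + 8 * (int r)\<^sup>2 * D"
    using bound_s[OF i2(1)] bound_s[OF D(2)] by (simp add: algebra_simps)
  then have "(9 * int r * int r - 8 * int r * int r - 2 * int r) * D \<le> 0"
    by (simp add: N_def power2_eq_square algebra_simps)
  moreover have "0 < 9 * int r * int r - 8 * int r * int r - 2 * int r"
  proof -
    have "2 * int r < int r * int r" using r by (intro mult_strict_right_mono) auto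
    then show ?thesis by linarith
  qed
  ultimately have "D \<le> 0" by (simp add: mult_le_0_iff)
  then have "s 0 = t 0" using gap_le[of 0 0] r by simp
  moreover have "meet 0 (A 0) (B 0)" using meets[of 0 0] r by simp
  ultimately show ?thesis
    using parallel_meet_eq[OF A B, of 0 0 0] r by (simp add: s_def t_def)
qed

lemma no_grid:
  assumes "grid \<A> \<B>"
  shows "\<A> = {}"
proof (rule ccontr)
  assume "\<A> \<noteq> {}"
  then obtain A B where "\<And>i. A i \<in> \<A>" "\<And>j. j < r \<Longrightarrow> B j \<in> \<B>"
    "\<And>i j. j < r \<Longrightarrow> meet ((i + j) mod r) (A i) (B j)"
    using grid_cyclic[OF assms] by metis
  moreover have "\<A> \<subseteq> Lines" "\<B> \<subseteq> Lines" "\<A> \<inter> \<B> = {}" using assms by (auto simp: grid_def)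
  ultimately have "A 0 = B 0" by (intro no_cyclic_grid) blast+
  moreover have "A 0 \<in> \<A>" by fact
  moreover have "B 0 \<in> \<B>" using \<open>\<And>j. j < r \<Longrightarrow> B j \<in> \<B>\<close> r by auto
  ultimately show False using \<open>\<A> \<inter> \<B> = {}\<close> by auto
qed

section \<open>Covering lines by lines\<close>

text \<open>Each line of \<open>Q\<close> covers at most one of the \<open>r\<close> points of \<open>a\<close>, so a cover by at most \<open>r\<close> lines is
  a bijection between colours and lines.\<close>

lemma line_cover:
  assumes a: "a \<in> Lines" "a \<notin> Q" and Q: "Q \<subseteq> Lines" "card Q \<le> r"
    and cover: "\<And>g. g < r \<Longrightarrow> \<exists>b\<in>Q. meet g a b"
  shows "card Q = r" and "\<And>g. g < r \<Longrightarrow> \<exists>!b. b \<in> Q \<and> meet g a b"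
    and "\<And>b. b \<in> Q \<Longrightarrow> \<exists>!g. g < r \<and> meet g a b"
proof -
  have once: "g = h" if "b \<in> Q" "meet g a b" "meet h a b" "g < r" "h < r" for b g h
    using meet_twice_eq[of a b g h] that a Q by blast
  obtain f where f: "\<And>g. g < r \<Longrightarrow> f g \<in> Q \<and> meet g a (f g)" using cover by metis
  have inj: "inj_on f {..<r}"
    using once f by (intro inj_onI) (metis lessThan_iff)
  have "finite Q" using Q finite_Lines finite_subset by blast
  moreover have "f ` {..<r} \<subseteq> Q" using f by auto
  moreover have "card (f ` {..<r}) = r" using inj by (simp add: card_image)
  ultimately have img: "f ` {..<r} = Q" using card_seteq[of Q "f ` {..<r}"] Q(2) by simp
  then show "card Q = r" using \<open>card (f ` {..<r}) = r\<close> by simp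
  show "\<exists>!g. g < r \<and> meet g a b" if "b \<in> Q" for b
    using img f once that by blast
  show "\<exists>!b. b \<in> Q \<and> meet g a b" if "g < r" for g
  proof (rule ex1I)
    show "f g \<in> Q \<and> meet g a (f g)" using f that by simp
    fix b assume b: "b \<in> Q \<and> meet g a b"
    then obtain h where "h < r" "b = f h" using img by auto
    then show "b = f g" using once[of b g h] f[of h] b that by auto
  qed
qed

text \<open>A line \<open>a\<close> of \<open>P\<close> outside \<open>Q\<close> forces \<open>card Q = r\<close>, hence also a line \<open>b\<close> of \<open>Q\<close> outside \<open>P\<close>. A
  common line \<open>l\<close> would form a triangle with \<open>a\<close> and \<open>b\<close>; without common lines the two sets are a
  grid.\<close>

lemma mutual_cover_subset:
  assumes P: "P \<subseteq> Lines" "card P \<le> r" and Q: "Q \<subseteq> Lines" "card Q \<le> r"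
    and coverP: "\<And>a g. a \<in> P \<Longrightarrow> g < r \<Longrightarrow> \<exists>b\<in>Q. meet g a b"
    and coverQ: "\<And>b g. b \<in> Q \<Longrightarrow> g < r \<Longrightarrow> \<exists>a\<in>P. meet g b a"
  shows "P \<subseteq> Q"
proof (rule ccontr)
  assume "\<not> P \<subseteq> Q"
  then obtain a where a: "a \<in> P" "a \<notin> Q" by blast
  have rowP: "card Q = r" "\<And>g. g < r \<Longrightarrow> \<exists>!b. b \<in> Q \<and> meet g a b"
      "\<And>b. b \<in> Q \<Longrightarrow> \<exists>!g. g < r \<and> meet g a b" if "a \<in> P" "a \<notin> Q" for a
    using line_cover[of a Q] coverP[OF that(1)] that P Q by blast+
  have rowQ: "card P = r" "\<And>g. g < r \<Longrightarrow> \<exists>!a. a \<in> P \<and> meet g b a"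
      "\<And>a. a \<in> P \<Longrightarrow> \<exists>!g. g < r \<and> meet g b a" if "b \<in> Q" "b \<notin> P" for b
    using line_cover[of b P] coverQ[OF that(1)] that P Q by blast+
  have "\<not> Q \<subseteq> P"
    using a P(2) rowP(1)[OF a] card_seteq[of P Q] finite_subset[OF P(1) finite_Lines] by auto
  then obtain b where b: "b \<in> Q" "b \<notin> P" by blast
  have "P \<inter> Q = {}"
  proof (rule ccontr)
    assume "P \<inter> Q \<noteq> {}"
    then obtain l where l: "l \<in> P" "l \<in> Q" by blast
    obtain i where i: "i < r" "meet i a b" using rowP(3)[OF a b(1)] by blast
    obtain j where j: "j < r" "meet j a l" using rowP(3)[OF a l(2)] by blast
    obtain k where k: "k < r" "meet k b l" using rowQ(3)[OF b l(1)] by blast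
    have "i \<noteq> j" using rowP(2)[OF a i(1)] i j b l by metis
    moreover have "i \<noteq> k" using rowQ(2)[OF b i(1)] i k a l meet_sym by metis
    moreover have "j \<noteq> k"
    proof
      assume "j = k"
      then have "meet j a b" using j k meet_sym meet_trans by blast
      then show False using rowP(3)[OF a b(1)] i j \<open>i \<noteq> j\<close> by blast
    qed
    ultimately have "a = b \<or> b = l \<or> a = l"
      using no_triangle[of a b l i k j] i j k a b l P(1) Q(1) by auto
    then show False using a b l by blast
  qed
  then have "grid P Q"
    unfolding grid_def using P Q rowP rowQ meet_sym
    by (intro conjI ballI allI impI) (simp_all, (metis disjoint_iff meet_sym)+)
  then show False using no_grid a by blast
qed

section \<open>The hypergraph of lines\<close>

definition point :: "nat \<Rightarrow> int \<times> int \<Rightarrow> nat" where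
  "point i l = i * m + nat ((fst l + c i * snd l) mod int m)"

definition edge :: "int \<times> int \<Rightarrow> nat set" where
  "edge l = (\<lambda>i. point i l) ` {..<r}"

lemma point_div_mod: "point i l div m = i" "point i l mod m = nat ((fst l + c i * snd l) mod int m)"
proof -
  have "nat ((fst l + c i * snd l) mod int m) < m" using m_pos by (simp add: nat_less_iff)
  then show "point i l div m = i" "point i l mod m = nat ((fst l + c i * snd l) mod int m)"
    by (simp_all add: point_def)
qed

lemma point_eq_iff: "point i l = point j l' \<longleftrightarrow> i = j \<and> meet i l l'"
proof
  assume eq: "point i l = point j l'"
  then have "i = j" using point_div_mod(1) by metis
  moreover have "nat ((fst l + c i * snd l) mod int m) = nat ((fst l' + c j * snd l') mod int m)"
    using eq point_div_mod(2) by metis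
  then have "(fst l + c i * snd l) mod int m = (fst l' + c j * snd l') mod int m"
    using m_pos by (simp add: nat_eq_iff)
  ultimately show "i = j \<and> meet i l l'" by (simp add: meet_def mod_eq_dvd_iff)
next
  assume "i = j \<and> meet i l l'"
  then show "point i l = point j l'" by (auto simp: point_def meet_def mod_eq_dvd_iff[symmetric])
qed

lemma point_in_edge_iff: "point i l \<in> edge l' \<longleftrightarrow> i < r \<and> meet i l l'"
  by (auto simp: edge_def point_eq_iff)

lemma edge_inj: "inj_on edge Lines"
proof (rule inj_onI)
  fix l l' assume l: "l \<in> Lines" "l' \<in> Lines" and eq: "edge l = edge l'"
  have "meet i l l'" if "i < r" for i
    using point_in_edge_iff[of i l l'] point_in_edge_iff[of i l l] eq that by simp
  then show "l = l'" using meet_twice_eq[OF l, of 0 1] r by simp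
qed

lemma card_edge: "card (edge l) = r"
  unfolding edge_def by (subst card_image) (auto intro: inj_onI simp: point_eq_iff)

lemma edge_subset: "edge l \<subseteq> {..<r * m}"
proof
  fix v assume "v \<in> edge l"
  then obtain i where "i < r" "v = point i l" by (auto simp: edge_def)
  then have "v div m < r" using point_div_mod(1) by simp
  then show "v \<in> {..<r * m}" using m_pos by (simp add: div_less_iff_less_mult)
qed

lemma edges_linear: "linear_hypergraph (edge ` Lines)"
  unfolding linear_hypergraph_def
proof (intro ballI impI)
  fix A B assume "A \<in> edge ` Lines" "B \<in> edge ` Lines" "A \<noteq> B"
  then obtain l l' where l: "l \<in> Lines" "l' \<in> Lines" "l \<noteq> l'" "A = edge l" "B = edge l'" by auto
  have "v = w" if vw: "v \<in> A \<inter> B" "w \<in> A \<inter> B" for v w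
  proof -
    obtain i j where ij: "i < r" "v = point i l" "j < r" "w = point j l"
      using vw l(4) by (auto simp: edge_def)
    then have "meet i l l'" "meet j l l'" using vw l(5) point_in_edge_iff by auto
    then show ?thesis using meet_twice_eq[of l l' i j] l ij by auto
  qed
  moreover have "finite (A \<inter> B)" using l by (simp add: edge_def)
  ultimately show "card (A \<inter> B) \<le> 1" by (auto simp: card_le_Suc0_iff_eq)
qed

text \<open>A line through a given vertex is determined by its slope, which can be prescribed: \<open>h s\<close> is the
  line of slope \<open>s\<close> through \<open>v\<close>.\<close>

lemma edges_regular: "regular (card S) {..<r * m} (edge ` Lines)"
  unfolding regular_def
proof
  fix v assume "v \<in> {..<r * m}"
  define i where "i = v div m"
  define h where "h = (\<lambda>s. ((int (v mod m) - c i * s) mod int m, s))"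
  have i: "i < r" using \<open>v \<in> {..<r * m}\<close> m_pos by (simp add: i_def div_less_iff_less_mult)
  have point: "point i l = v \<longleftrightarrow> l = h (snd l)" if "l \<in> Lines" for l
  proof -
    have "point i l = v \<longleftrightarrow> point i l mod m = v mod m"
      using point_div_mod(1)[of i l] div_mult_mod_eq[of v m] div_mult_mod_eq[of "point i l" m]
      by (metis i_def)
    also have "\<dots> \<longleftrightarrow> nat ((fst l + c i * snd l) mod int m) = v mod m"
      by (simp add: point_div_mod(2))
    also have "\<dots> \<longleftrightarrow> (fst l + c i * snd l) mod int m = int (v mod m) mod int m"
      using m_pos by (auto simp: nat_eq_iff zmod_int)
    also have "\<dots> \<longleftrightarrow> fst l mod int m = (int (v mod m) - c i * snd l) mod int m"
      by (simp add: mod_eq_dvd_iff algebra_simps)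
    also have "fst l mod int m = fst l" using LinesD(2,3)[OF that] by simp
    finally show ?thesis by (auto simp: h_def prod_eq_iff)
  qed
  have "{A \<in> edge ` Lines. v \<in> A} = edge ` h ` S"
  proof (intro equalityI subsetI)
    fix A assume "A \<in> {A \<in> edge ` Lines. v \<in> A}"
    then obtain l where l: "l \<in> Lines" "A = edge l" "v \<in> edge l" by auto
    then obtain j where "v = point j l" by (auto simp: edge_def)
    then have "point i l = v" using point_div_mod(1) by (simp add: i_def)
    then have "l = h (snd l)" using point l by blast
    then show "A \<in> edge ` h ` S" using l LinesD(1) by blast
  next
    fix A assume "A \<in> edge ` h ` S"
    then obtain s where s: "s \<in> S" "A = edge (h s)" by auto
    have "h s \<in> Lines" using s m_pos by (simp add: h_def Lines_def)
    moreover from this have "point i (h s) = v" using point[of "h s"] by (simp add: h_def)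
    ultimately show "A \<in> {A \<in> edge ` Lines. v \<in> A}" using s i by (auto simp: edge_def)
  qed
  moreover have "card (edge ` h ` S) = card S"
  proof -
    have "h ` S \<subseteq> Lines" using m_pos by (auto simp: h_def Lines_def)
    then have "inj_on edge (h ` S)" using edge_inj inj_on_subset by blast
    moreover have "inj_on h S" by (auto intro: inj_onI simp: h_def)
    ultimately show ?thesis by (simp add: card_image)
  qed
  ultimately show "card {A \<in> edge ` Lines. v \<in> A} = card S" by simp
qed

definition lines_of :: "nat set set \<Rightarrow> (int \<times> int) set" where
  "lines_of \<A> = {l \<in> Lines. edge l \<in> \<A>}"

lemma lines_of:
  assumes "\<A> \<subseteq> edge ` Lines"
  shows "lines_of \<A> \<subseteq> Lines" "edge ` lines_of \<A> = \<A>" "card (lines_of \<A>) = card \<A>"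
proof -
  show sub: "lines_of \<A> \<subseteq> Lines" by (auto simp: lines_of_def)
  show img: "edge ` lines_of \<A> = \<A>" using assms by (auto simp: lines_of_def)
  show "card (lines_of \<A>) = card \<A>"
    using card_image[OF inj_on_subset[OF edge_inj sub]] img by simp
qed

lemma lines_of_cover:
  assumes "\<B> \<subseteq> edge ` Lines" "edge a \<subseteq> \<Union>\<B>" "g < r"
  shows "\<exists>b\<in>lines_of \<B>. meet g a b"
proof -
  have "point g a \<in> edge a" using assms(3) by (simp add: point_in_edge_iff)
  then obtain B where B: "B \<in> \<B>" "point g a \<in> B" using assms(2) by blast
  then obtain b where "b \<in> Lines" "B = edge b" using assms(1) by blast
  then have "b \<in> lines_of \<B>" "meet g a b" using B by (auto simp: lines_of_def point_in_edge_iff)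
  then show ?thesis by blast
qed

lemma edges_cover_free: "cover_free (r - 1) (edge ` Lines)"
  unfolding cover_free_def
proof (intro allI impI notI, elim conjE)
  fix A :: "nat \<Rightarrow> nat set"
  assume inj: "inj_on A {0..r - 1}" and sub: "A ` {0..r - 1} \<subseteq> edge ` Lines"
    and cover: "A 0 \<subseteq> (\<Union>i\<in>{1..r - 1}. A i)"
  define \<B> where "\<B> = A ` {1..r - 1}"
  have \<B>: "\<B> \<subseteq> edge ` Lines" using sub by (auto simp: \<B>_def)
  have "card \<B> \<le> card {1..r - 1}" unfolding \<B>_def by (rule card_image_le) simp
  then have less: "card \<B> < r" using r by simp
  have "A 0 \<in> edge ` Lines" using sub by (auto simp: image_subset_iff)
  then obtain a where a: "a \<in> Lines" "A 0 = edge a" by blast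
  have "A 0 \<noteq> A i" if "i \<in> {1..r - 1}" for i
    using inj_onD[OF inj, of 0 i] that by auto
  then have "A 0 \<notin> \<B>" unfolding \<B>_def by blast
  then have "a \<notin> lines_of \<B>" using a by (simp add: lines_of_def)
  moreover have "edge a \<subseteq> \<Union>\<B>" using cover a by (simp add: \<B>_def)
  ultimately have "card (lines_of \<B>) = r"
    using line_cover(1)[of a "lines_of \<B>"] a lines_of[OF \<B>] lines_of_cover[OF \<B>] less by auto
  then show False using lines_of(3)[OF \<B>] less by simp
qed

lemma edges_union_free: "union_free r (edge ` Lines)"
  unfolding union_free_def
proof (intro allI impI notI, elim conjE)
  fix \<A> \<B> assume sub: "\<A> \<subseteq> edge ` Lines" "\<B> \<subseteq> edge ` Lines" and ne: "\<A> \<noteq> \<B>"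
    and card: "card \<A> \<le> r" "card \<B> \<le> r" and eq: "\<Union>\<A> = \<Union>\<B>"
  have cover: "\<exists>b\<in>lines_of \<B>. meet g a b" if "a \<in> lines_of \<A>" "g < r" for a g
  proof -
    have "edge a \<subseteq> \<Union>\<B>" using that(1) eq by (auto simp: lines_of_def)
    then show ?thesis using lines_of_cover[OF sub(2) _ that(2)] by blast
  qed
  have cover': "\<exists>a\<in>lines_of \<A>. meet g b a" if "b \<in> lines_of \<B>" "g < r" for b g
  proof -
    have "edge b \<subseteq> \<Union>\<A>" using that(1) eq by (auto simp: lines_of_def)
    then show ?thesis using lines_of_cover[OF sub(1) _ that(2)] by blast
  qed
  note A = lines_of[OF sub(1)] and B = lines_of[OF sub(2)]
  have "lines_of \<A> \<subseteq> lines_of \<B>"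
    by (rule mutual_cover_subset) (use A B card cover cover' in auto)
  moreover have "lines_of \<B> \<subseteq> lines_of \<A>"
    by (rule mutual_cover_subset) (use A B card cover cover' in auto)
  ultimately show False using A(2) B(2) ne by (metis subset_antisym)
qed

lemma edges_optimal_design: "optimal_superimposed_design r (card S) {..<r * m} (edge ` Lines)"
  unfolding optimal_superimposed_design_def optimal_superimposed_code_def
  using edges_cover_free edges_linear edges_regular edges_union_free edge_subset
  by (auto simp: uniform_def card_edge)

end

section \<open>Designs of large degree\<close>

lemma design_of_average_free_set:
  assumes "4 \<le> r" "0 < m" "average_free (slope_bound r) S" "finite S"
    and "\<And>s. s \<in> S \<Longrightarrow> 0 \<le> s \<and> 2 * slope_bound r * s < int m"
  shows "\<exists>F. optimal_superimposed_design r (card S) {..<r * m} F"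
proof -
  interpret line_system r m S using assms by unfold_locales auto
  show ?thesis using edges_optimal_design by blast
qed

theorem corollary1p15:
  fixes r :: nat
  assumes "r \<ge> 4"
  shows "\<exists>\<beta>::real. \<beta> > 0 \<and> (\<exists>n0::nat. \<forall>n\<ge>n0. r dvd n \<longrightarrow>
    (\<forall>k::nat. 1 \<le> k \<and> real k \<le> real n * exp (- \<beta> * sqrt (ln (real n))) \<longrightarrow>
       (\<exists>F. optimal_superimposed_design r k {..<n} F)) \<and>
    real n * exp (- \<beta> * sqrt (ln (real n))) \<le> real (max_design_degree r n))"
proof -
  have C: "1 \<le> slope_bound r" unfolding slope_bound_def using assms by linarith
  then have "0 < 2 * slope_bound r * int r" using assms by simp
  obtain \<beta> :: real and n0 where \<beta>: "\<beta> > 0" and sets: "\<And>n. n0 \<le> n \<Longrightarrow>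
      \<exists>S. average_free (slope_bound r) S \<and> finite S \<and>
        real n * exp (- \<beta> * sqrt (ln (real n))) \<le> real (card S) \<and>
        (\<forall>s\<in>S. 0 \<le> s \<and> 2 * slope_bound r * int r * s < int n)"
    using large_average_free_sets[OF C \<open>0 < 2 * slope_bound r * int r\<close>] by metis
  have design: "\<exists>K. real n * exp (- \<beta> * sqrt (ln (real n))) \<le> real K \<and>
      (\<forall>k\<le>K. \<exists>F. optimal_superimposed_design r k {..<n} F)"
    if n: "max n0 1 \<le> n" "r dvd n" for n
  proof -
    obtain m where m: "n = r * m" using n(2) by blast
    then have "0 < m" using n(1) by (cases m) auto
    obtain S where S: "average_free (slope_bound r) S" "finite S"
        "real n * exp (- \<beta> * sqrt (ln (real n))) \<le> real (card S)"
        "\<And>s. s \<in> S \<Longrightarrow> 0 \<le> s \<and> 2 * slope_bound r * int r * s < int n"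
      using sets[of n] n(1) by auto
    have small: "2 * slope_bound r * s < int m" if "s \<in> S" for s
    proof -
      have "int r * (2 * slope_bound r * s) < int r * int m"
        using S(4)[OF that] m by (simp add: ac_simps)
      then show ?thesis using assms by (simp add: mult_less_cancel_left)
    qed
    have "\<exists>F. optimal_superimposed_design r k {..<n} F" if k: "k \<le> card S" for k
    proof -
      obtain T where T: "T \<subseteq> S" "card T = k" "finite T"
        using obtain_subset_with_card_n[OF k] by metis
      have "\<exists>F. optimal_superimposed_design r (card T) {..<r * m} F"
        using assms \<open>0 < m\<close> average_free_mono[OF S(1) T(1)] T(3)
        by (rule design_of_average_free_set) (use S(4) small T(1) in blast)
      then show ?thesis using T(2) m by simp
    qed
    then show ?thesis using S(3) by blast
  qed
  show ?thesis
  proof (intro exI[of _ \<beta>] exI[of _ "max n0 1"] conjI allI impI)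
    show "\<beta> > 0" by (rule \<beta>)
  next
    fix n k
    assume n: "max n0 1 \<le> n" "r dvd n"
      and k: "1 \<le> k \<and> real k \<le> real n * exp (- \<beta> * sqrt (ln (real n)))"
    obtain K where K: "real n * exp (- \<beta> * sqrt (ln (real n))) \<le> real K"
        "\<forall>k\<le>K. \<exists>F. optimal_superimposed_design r k {..<n} F"
      using design[OF n] by blast
    have "real k \<le> real K" using k K(1) by linarith
    then show "\<exists>F. optimal_superimposed_design r k {..<n} F" using K(2) by simp
  next
    fix n assume n: "max n0 1 \<le> n" "r dvd n"
    obtain K where K: "real n * exp (- \<beta> * sqrt (ln (real n))) \<le> real K"
        "\<forall>k\<le>K. \<exists>F. optimal_superimposed_design r k {..<n} F"
      using design[OF n] by blast
    have "K \<in> design_degrees r n" using K(2) by (simp add: design_degrees_def)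
    then have "K \<le> max_design_degree r n"
      unfolding max_design_degree_def using n(1) by (intro Max_ge finite_design_degrees) auto
    then show "real n * exp (- \<beta> * sqrt (ln (real n))) \<le> real (max_design_degree r n)"
      using K(1) by linarith
  qed
qed

end
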